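(* For every positive integer $n$, there are at most $2^{\binom{n+1}{2}}$ distinct Hadamard matrices of order $n$.
   Context: A Hadamard matrix of order $n$ is an $n\times n$ matrix with entries in $\{-1,1\}$ such that the inner product of any two distinct rows equals zero. *)

theory Defs
  imports "Jordan_Normal_Form.Matrix"
begin

definition hadamard_matrix :: "nat \<Rightarrow> real mat \<Rightarrow> bool" where
  "hadamard_matrix n H \<longleftrightarrow>
     H \<in> carrier_mat n n \<and>
     (\<forall>i<n. \<forall>j<n. H $$ (i, j) \<in> {-1, 1}) \<and>
     (\<forall>i<n. \<forall>j<n. i \<noteq> j \<longrightarrow> row H i \<bullet> row H j = 0)"

end

theory Submission
  imports Defs
begin

text \<open>
  A Hadamard matrix is built row by row, and the bound is the product of the numbers of choices
  for the rows. Once \<open>k\<close> pairwise orthogonal rows are chosen, the next row is a vector of signs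
  in their orthogonal complement, a space of dimension \<open>n - k\<close>. A vector of a space of dimension
  \<open>d\<close> is determined by \<open>d\<close> suitably chosen coordinates, so the space contains at most \<open>2^d\<close>
  vectors of signs. Hence there are at most \<open>2^n * 2^(n-1) * \<dots> * 2^1\<close> matrices, and
  \<open>n + (n-1) + \<dots> + 1\<close> is the binomial coefficient.

  Dimension theory is replaced by an exchange argument (\<open>determining_drop_coordinate\<close>): if a set
  of coordinates determines the vectors of a subspace, and the subspace is cut down to the
  orthogonal complement of one of its own nonzero members, then some coordinate becomes
  superfluous. Starting from all \<open>n\<close> coordinates, every further row removes one of them.
\<close>

section \<open>Coordinates that determine the vectors of an orthogonal complement\<close>

definition perp :: "nat \<Rightarrow> real vec set \<Rightarrow> real vec set" where
  "perp n A = {v \<in> carrier_vec n. \<forall>a\<in>A. v \<bullet> a = 0}"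

text \<open>The restriction to \<open>C\<close> is linear on the complement, so it is injective as soon as its kernel
  is trivial; the kernel form is the one that the exchange argument manipulates.\<close>

definition determining :: "nat \<Rightarrow> nat set \<Rightarrow> real vec set \<Rightarrow> bool" where
  "determining n C A \<longleftrightarrow> C \<subseteq> {..<n} \<and> (\<forall>v\<in>perp n A. (\<forall>c\<in>C. v $ c = 0) \<longrightarrow> v = 0\<^sub>v n)"

lemma minus_in_perp:
  assumes "A \<subseteq> carrier_vec n" "u \<in> perp n A" "v \<in> perp n A"
  shows "u - v \<in> perp n A"
  using assms by (auto simp: perp_def minus_scalar_prod_distrib[where n = n] subset_iff)

lemma determining_eqI:
  assumes A: "A \<subseteq> carrier_vec n" and C: "determining n C A"
    and uv: "u \<in> perp n A" "v \<in> perp n A" and eq: "\<And>c. c \<in> C \<Longrightarrow> u $ c = v $ c"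
  shows "u = v"
proof -
  have un: "u \<in> carrier_vec n" and vn: "v \<in> carrier_vec n"
    using uv by (auto simp: perp_def)
  have "C \<subseteq> {..<n}"
    using C by (simp add: determining_def)
  then have "\<forall>c\<in>C. (u - v) $ c = 0"
    using eq un vn by (auto simp: subset_iff)
  then have zero: "u - v = 0\<^sub>v n"
    using C minus_in_perp[OF A uv] by (simp add: determining_def)
  have diff: "(u - v) $ i = 0" if "i < n" for i
    using zero that by simp
  show ?thesis
  proof (rule eq_vecI)
    show "u $ i = v $ i" if "i < dim_vec v" for i
      using diff[of i] that un vn by auto
  qed (use un vn in auto)
qed

lemma linear_combination_in_perp:
  assumes "A \<subseteq> carrier_vec n" "\<And>c. c \<in> C \<Longrightarrow> e c \<in> perp n A"
  shows "vec n (\<lambda>i. \<Sum>c\<in>C. k c * e c $ i) \<in> perp n A"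
proof -
  have "vec n (\<lambda>i. \<Sum>c\<in>C. k c * e c $ i) \<bullet> a = 0" if "a \<in> A" for a
  proof -
    have a: "dim_vec a = n"
      using assms(1) that by auto
    have "vec n (\<lambda>i. \<Sum>c\<in>C. k c * e c $ i) \<bullet> a = (\<Sum>i<n. \<Sum>c\<in>C. k c * e c $ i * a $ i)"
      by (simp add: scalar_prod_def a sum_distrib_right lessThan_atLeast0)
    also have "\<dots> = (\<Sum>c\<in>C. \<Sum>i<n. k c * e c $ i * a $ i)"
      by (rule sum.swap)
    also have "\<dots> = (\<Sum>c\<in>C. k c * (e c \<bullet> a))"
      by (simp add: scalar_prod_def a sum_distrib_left lessThan_atLeast0 mult.assoc)
    also have "\<dots> = 0"
      using assms(2) that by (auto simp: perp_def intro: sum.neutral)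
    finally show ?thesis .
  qed
  then show ?thesis
    by (simp add: perp_def)
qed

lemma scalar_prod_self_eq_0:
  fixes w :: "real vec"
  assumes "w \<in> carrier_vec n" "w \<bullet> w = 0"
  shows "w = 0\<^sub>v n"
proof -
  have "\<forall>i\<in>{0..<n}. w $ i * w $ i = 0"
    using assms by (subst sum_nonneg_eq_0_iff[symmetric]) (auto simp: scalar_prod_def)
  then show ?thesis
    using assms(1) by (intro eq_vecI) auto
qed

text \<open>Suppose that no coordinate of \<open>C\<close> can be dropped. Then for every \<open>c \<in> C\<close> the smaller
  complement contains a vector that vanishes on \<open>C\<close> except at \<open>c\<close>. These vectors form a dual basis
  for \<open>C\<close>, and expanding \<open>w\<close> in it places \<open>w\<close> in its own orthogonal complement.\<close>

lemma determining_drop_coordinate: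
  assumes A: "A \<subseteq> carrier_vec n" and C: "determining n C A"
    and w: "w \<in> perp n A" "w \<noteq> 0\<^sub>v n"
  shows "\<exists>c\<in>C. determining n (C - {c}) (insert w A)"
proof (rule ccontr)
  assume neg: "\<not> ?thesis"
  have Cn: "C \<subseteq> {..<n}" and fin: "finite C"
    using C by (auto simp: determining_def intro: finite_subset)
  have wn: "w \<in> carrier_vec n"
    using w(1) by (simp add: perp_def)
  have sub: "perp n (insert w A) \<subseteq> perp n A"
    by (auto simp: perp_def)
  have "\<exists>v. v \<in> perp n (insert w A) \<and> v $ c \<noteq> 0 \<and> (\<forall>d\<in>C - {c}. v $ d = 0)" if "c \<in> C" for c
  proof -
    have "\<not> determining n (C - {c}) (insert w A)"
      using neg that by blast
    then obtain v where v: "v \<in> perp n (insert w A)" "\<forall>d\<in>C - {c}. v $ d = 0" "v \<noteq> 0\<^sub>v n"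
      using Cn by (auto simp: determining_def)
    then have "v $ c \<noteq> 0"
      using C sub unfolding determining_def by blast
    then show ?thesis
      using v by blast
  qed
  then obtain e where
    e: "\<And>c. c \<in> C \<Longrightarrow> e c \<in> perp n (insert w A) \<and> e c $ c \<noteq> 0 \<and> (\<forall>d\<in>C - {c}. e c $ d = 0)"
    by metis
  define u where "u = vec n (\<lambda>i. \<Sum>c\<in>C. w $ c / e c $ c * e c $ i)"
  have u: "u \<in> perp n (insert w A)"
    unfolding u_def using A wn e by (intro linear_combination_in_perp) auto
  have agree: "u $ d = w $ d" if "d \<in> C" for d
  proof -
    have "u $ d = (\<Sum>c\<in>C. w $ c / e c $ c * e c $ d)"
      using that Cn by (auto simp: u_def)
    also have "\<dots> = (\<Sum>c\<in>C. if c = d then w $ d else 0)"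
      using e that by (intro sum.cong) auto
    finally show ?thesis
      using that fin by simp
  qed
  have "u = w"
    by (rule determining_eqI[OF A C _ w(1) agree]) (use u sub in auto)
  then have "w \<bullet> w = 0"
    using u by (simp add: perp_def)
  then show False
    using scalar_prod_self_eq_0[OF wn] w(2) by blast
qed

section \<open>Orthogonal lists of sign vectors\<close>

definition sign_vecs :: "nat \<Rightarrow> real vec set" where
  "sign_vecs n = {v \<in> carrier_vec n. \<forall>i<n. v $ i \<in> {-1, 1}}"

definition orthogonal_sign_lists :: "nat \<Rightarrow> nat \<Rightarrow> real vec list set" where
  "orthogonal_sign_lists n k =
     {xs. length xs = k \<and> set xs \<subseteq> sign_vecs n \<and> sorted_wrt (\<lambda>x y. x \<bullet> y = 0) xs}"

lemma sign_vec_nonzero: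
  assumes "n > 0" "v \<in> sign_vecs n"
  shows "v \<noteq> 0\<^sub>v n"
  using assms by (auto simp: sign_vecs_def)

lemma sign_vecs_carrier: "sign_vecs n \<subseteq> carrier_vec n"
  by (auto simp: sign_vecs_def)

text \<open>A sign vector of the complement is recovered from the subset of \<open>C\<close> on which it is positive,
  so there are at most as many as subsets of \<open>C\<close>.\<close>

lemma card_sign_vecs_perp:
  assumes A: "A \<subseteq> carrier_vec n" and C: "determining n C A"
  shows "finite (sign_vecs n \<inter> perp n A)" "card (sign_vecs n \<inter> perp n A) \<le> 2 ^ card C"
proof -
  have Cn: "C \<subseteq> {..<n}" and fin: "finite C"
    using C by (auto simp: determining_def intro: finite_subset)
  let ?S = "sign_vecs n \<inter> perp n A" and ?f = "\<lambda>v::real vec. {c \<in> C. v $ c = 1}"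
  have inj: "inj_on ?f ?S"
  proof (rule inj_onI)
    fix u v assume u: "u \<in> ?S" and v: "v \<in> ?S" and eq: "?f u = ?f v"
    have agree: "u $ c = v $ c" if "c \<in> C" for c
    proof -
      have "c < n"
        using that Cn by auto
      then have "u $ c \<in> {-1, 1}" "v $ c \<in> {-1, 1}"
        using u v by (auto simp: sign_vecs_def)
      moreover have "u $ c = 1 \<longleftrightarrow> v $ c = 1"
        using eq that by blast
      ultimately show ?thesis
        by auto
    qed
    show "u = v"
      by (rule determining_eqI[OF A C _ _ agree]) (use u v in auto)
  qed
  have img: "?f ` ?S \<subseteq> Pow C"
    by auto
  show "finite ?S"
    using inj_on_finite[OF inj img] fin by simp
  show "card ?S \<le> 2 ^ card C"
    using card_inj_on_le[OF inj img] fin by (simp add: card_Pow)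
qed

text \<open>All \<open>n\<close> coordinates determine a vector, and each member of the list lies in the complement of
  those after it and is nonzero, so it makes one coordinate superfluous. The equation on
  cardinalities also shows that such a list has length at most \<open>n\<close>.\<close>

lemma orthogonal_signs_determining:
  assumes "n > 0" "xs \<in> orthogonal_sign_lists n k"
  shows "\<exists>C. determining n C (set xs) \<and> card C + k = n"
  using assms(2)
proof (induction xs arbitrary: k)
  case Nil
  have "determining n {..<n} {}"
    by (auto simp: determining_def perp_def)
  then show ?case
    using Nil by (auto simp: orthogonal_sign_lists_def)
next
  case (Cons x xs)
  then obtain k' where k: "k = Suc k'" and xs: "xs \<in> orthogonal_sign_lists n k'"
    and x: "x \<in> sign_vecs n" "x \<in> perp n (set xs)"
    by (auto simp: orthogonal_sign_lists_def perp_def sign_vecs_def)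
  obtain C where C: "determining n C (set xs)" "card C + k' = n"
    using Cons.IH[OF xs] by blast
  have "set xs \<subseteq> carrier_vec n"
    using xs sign_vecs_carrier by (auto simp: orthogonal_sign_lists_def)
  then obtain c where c: "c \<in> C" "determining n (C - {c}) (set (x # xs))"
    using determining_drop_coordinate[OF _ C(1) x(2) sign_vec_nonzero[OF assms(1) x(1)]] by auto
  have "finite C"
    using C(1) by (auto simp: determining_def intro: finite_subset)
  then have "card C = Suc (card (C - {c}))"
    using c(1) by (rule card.remove)
  then show ?case
    using c(2) C(2) k by auto
qed

lemma card_orthogonal_sign_lists:
  assumes "n > 0"
  shows "finite (orthogonal_sign_lists n k) \<and>
    card (orthogonal_sign_lists n k) \<le> 2 ^ (\<Sum>j<k. n - j)"
proof (induction k)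
  case 0
  have "orthogonal_sign_lists n 0 = {[]}"
    by (auto simp: orthogonal_sign_lists_def)
  then show ?case
    by simp
next
  case (Suc k)
  let ?L = "orthogonal_sign_lists n"
  let ?E = "\<lambda>xs. (\<lambda>x. x # xs) ` (sign_vecs n \<inter> perp n (set xs))"
  have E: "finite (?E xs) \<and> card (?E xs) \<le> 2 ^ (n - k)" if xs: "xs \<in> ?L k" for xs
  proof -
    obtain C where C: "determining n C (set xs)" "card C + k = n"
      using orthogonal_signs_determining[OF assms xs] by blast
    have "set xs \<subseteq> carrier_vec n"
      using xs sign_vecs_carrier by (auto simp: orthogonal_sign_lists_def)
    note bound = card_sign_vecs_perp[OF this C(1)]
    moreover have "card C = n - k"
      using C(2) by simp
    ultimately show ?thesis
      using card_image_le[OF bound(1)] by (auto intro: order_trans)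
  qed
  have sub: "?L (Suc k) \<subseteq> (\<Union>xs\<in>?L k. ?E xs)"
  proof
    fix ys assume ys: "ys \<in> ?L (Suc k)"
    then obtain x xs where "ys = x # xs"
      by (cases ys) (auto simp: orthogonal_sign_lists_def)
    then show "ys \<in> (\<Union>xs\<in>?L k. ?E xs)"
      using ys by (auto simp: orthogonal_sign_lists_def perp_def sign_vecs_def)
  qed
  have fin: "finite (\<Union>xs\<in>?L k. ?E xs)"
    using Suc E by blast
  have "card (?L (Suc k)) \<le> card (\<Union>xs\<in>?L k. ?E xs)"
    using card_mono[OF fin sub] .
  also have "\<dots> \<le> (\<Sum>xs\<in>?L k. card (?E xs))"
    using Suc by (intro card_UN_le) auto
  also have "\<dots> \<le> card (?L k) * 2 ^ (n - k)"
    using sum_bounded_above[of "?L k" "\<lambda>xs. card (?E xs)" "2 ^ (n - k)"] E by simp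
  also have "\<dots> \<le> 2 ^ (\<Sum>j<k. n - j) * 2 ^ (n - k)"
    using Suc by simp
  finally have "card (?L (Suc k)) \<le> 2 ^ (\<Sum>j<Suc k. n - j)"
    by (simp add: power_add)
  then show ?case
    using finite_subset[OF sub fin] by blast
qed

section \<open>Counting Hadamard matrices\<close>

lemma rows_hadamard_matrix:
  assumes "hadamard_matrix n H"
  shows "rows H \<in> orthogonal_sign_lists n n"
proof -
  have H: "H \<in> carrier_mat n n" and entries: "\<forall>i<n. \<forall>j<n. H $$ (i, j) \<in> {-1, 1}"
    and orth: "\<forall>i<n. \<forall>j<n. i \<noteq> j \<longrightarrow> row H i \<bullet> row H j = 0"
    using assms by (simp_all add: hadamard_matrix_def)
  have "row H i \<in> sign_vecs n" if "i < n" for i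
    using H entries that unfolding sign_vecs_def by simp
  then have "set (rows H) \<subseteq> sign_vecs n"
    using H by (auto simp: rows_def)
  then show ?thesis
    using H orth by (auto simp: orthogonal_sign_lists_def sorted_wrt_iff_nth_less)
qed

lemma inj_on_rows: "inj_on rows (carrier_mat n m)"
proof (rule inj_onI)
  fix G H :: "'a mat"
  assume "G \<in> carrier_mat n m" "H \<in> carrier_mat n m" "rows G = rows H"
  then show "G = H"
    by (metis mat_of_rows_rows carrier_matD(2))
qed

lemma sum_descending_eq_choose: "(\<Sum>j<n. n - j) = (n + 1) choose 2"
proof -
  have "(\<Sum>j<n. n - j) = (\<Sum>i<n. Suc i)"
    by (subst sum.nat_diff_reindex[symmetric]) (auto intro: sum.cong)
  also have "\<dots> = \<Sum>{0..n}"
    by (induction n) auto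
  also have "\<dots> = (n + 1) choose 2"
    by (simp add: gauss_sum_nat choose_two mult.commute)
  finally show ?thesis .
qed

theorem theorem3:
  fixes n :: nat
  assumes "n > 0"
  shows "finite {H. hadamard_matrix n H} \<and>
    card {H. hadamard_matrix n H} \<le> 2 ^ ((n + 1) choose 2)"
proof -
  let ?M = "{H. hadamard_matrix n H}"
  have inj: "inj_on rows ?M"
    by (rule inj_on_subset[OF inj_on_rows[of n n]]) (auto simp: hadamard_matrix_def)
  have img: "rows ` ?M \<subseteq> orthogonal_sign_lists n n"
    using rows_hadamard_matrix by auto
  note bound = card_orthogonal_sign_lists[OF assms, of n]
  have "finite ?M"
    using inj_on_finite[OF inj img] bound by blast
  moreover have "card ?M \<le> card (orthogonal_sign_lists n n)"
    using card_inj_on_le[OF inj img] bound by blast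
  ultimately show ?thesis
    using bound by (simp add: sum_descending_eq_choose)
qed

end
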